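(* Let $m,n$ be positive integers. For any $q\in\mathbb{R}^n$ and any $P$ tensor $\mathcal{A}\in T_{m,n}$, the solution set of the tensor complementarity problem $\mathrm{TCP}(q,\mathcal{A})$ is nonempty and compact.
   Context: Write $[n]=\{1,\dots,n\}$. $T_{m,n}$ denotes the set of all real $m$th order $n$-dimensional tensors $\mathcal{A}=(a_{i_1i_2\cdots i_m})$, $i_1,\dots,i_m\in[n]$ (no symmetry assumed). For $x\in\mathbb{R}^n$, $\mathcal{A}x^{m-1}\in\mathbb{R}^n$ is defined by $(\mathcal{A}x^{m-1})_i=\sum_{i_2,\dots,i_m=1}^n a_{ii_2\cdots i_m}x_{i_2}\cdots x_{i_m}$ for $i\in[n]$. For $q\in\mathbb{R}^n$, $\mathrm{TCP}(q,\mathcal{A})$ is the problem of finding $x\in\mathbb{R}^n$ such that $x\ge 0$, $\mathcal{A}x^{m-1}+q\ge 0$ and $x^T(\mathcal{A}x^{m-1}+q)=0$ (inequalities componentwise); its solution set is the set of all such $x$. $\mathcal{A}\in T_{m,n}$ is a $P$ tensor iff for each $x\in\mathbb{R}^n\setminus\{0\}$ there exists $i\in[n]$ such that $x_i(\mathcal{A}x^{m-1})_i>0$. *)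

theory Defs
  imports "HOL-Analysis.Analysis"
begin

text \<open>
  The index set \<open>[n]\<close> is a finite type \<open>'n\<close>. An order-\<open>m\<close> tensor is a family of reals indexed by
  the multi-indices \<open>(i\<^sub>1, \<dots>, i\<^sub>m)\<close>, i.e. the lists of length \<open>m\<close> over \<open>'n\<close>; it is extended by
  zero to lists of other lengths, so that tensors and coefficient families correspond one-to-one.
\<close>

definition tensors :: "nat \<Rightarrow> ('n::finite list \<Rightarrow> real) set" where
  "tensors m = {A. \<forall>js. length js \<noteq> m \<longrightarrow> A js = 0}"

text \<open>The vector \<open>A x\<^bsup>m-1\<^esup>\<close>; meant for \<open>m \<ge> 1\<close>, as subtraction on \<open>nat\<close> truncates.\<close>

definition tensor_apply :: "nat \<Rightarrow> ('n::finite list \<Rightarrow> real) \<Rightarrow> real ^ 'n \<Rightarrow> real ^ 'n" where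
  "tensor_apply m A x =
     (\<chi> i. \<Sum>js \<in> {js. length js = m - 1}. A (i # js) * (\<Prod>j\<leftarrow>js. x $ j))"

definition P_tensor :: "nat \<Rightarrow> ('n::finite list \<Rightarrow> real) \<Rightarrow> bool" where
  "P_tensor m A \<longleftrightarrow>
     A \<in> tensors m \<and> (\<forall>x::real ^ 'n. x \<noteq> 0 \<longrightarrow> (\<exists>i. x $ i * tensor_apply m A x $ i > 0))"

text \<open>The order on \<open>real ^ 'n\<close> is componentwise.\<close>

definition TCP_solutions ::
  "nat \<Rightarrow> real ^ 'n \<Rightarrow> ('n::finite list \<Rightarrow> real) \<Rightarrow> (real ^ 'n) set" where
  "TCP_solutions m q A =
     {x. x \<ge> 0 \<and> tensor_apply m A x + q \<ge> 0 \<and> x \<bullet> (tensor_apply m A x + q) = 0}"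

end

theory Submission
  imports Defs
begin

text \<open>
  The map \<open>F x = A x\<^bsup>m-1\<^esup>\<close> is continuous and homogeneous of degree \<open>m - 1\<close>. Existence
  comes from truncation: Brouwer's theorem, applied to a step \<open>x - (F x + q)\<close> clamped back to the
  box \<open>[0,r]\<^sup>n\<close>, solves the complementarity problem except that \<open>F x + q\<close> may be negative in
  coordinates where \<open>x\<close> touches the upper face (\<open>box_complementarity\<close>).

  Both solutions and such truncated solutions are \<open>x \<ge> 0\<close> with \<open>(F x + q)\<^sub>i \<le> 0\<close> wherever
  \<open>x\<^sub>i > 0\<close>. The vectors with this property form a bounded set (\<open>homogeneous_P_bounded\<close>): by
  compactness of the sphere, the \<open>P\<close> property makes the sum of the positive parts of
  \<open>x\<^sub>i (F x)\<^sub>i\<close> at least \<open>c \<parallel>x\<parallel>\<^sup>m\<close> for some \<open>c > 0\<close>, while \<open>(F x)\<^sub>i \<le> - q\<^sub>i\<close> on the support of \<open>x\<close>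
  bounds it by a constant times \<open>\<parallel>x\<parallel>\<close>, which is of lower order when \<open>m \<ge> 2\<close>. So for \<open>r\<close> beyond
  this bound no truncated solution touches the upper faces, and it solves the problem; and the
  solution set, which is closed by continuity, is bounded. For \<open>m = 1\<close> the map \<open>F\<close> is
  a constant \<open>a\<close>, and the \<open>P\<close> property fails at \<open>x = - a\<close> or, when \<open>a = 0\<close>, at every \<open>x\<close>.
\<close>

section \<open>The map defined by a tensor\<close>

lemma prod_list_scaled:
  fixes f :: "'a \<Rightarrow> 'b::comm_monoid_mult"
  shows "(\<Prod>j\<leftarrow>js. t * f j) = t ^ length js * (\<Prod>j\<leftarrow>js. f j)"
  by (induction js) (simp_all add: mult_ac)

lemma tensor_apply_scaleR: "tensor_apply m A (t *\<^sub>R x) = t ^ (m - 1) *\<^sub>R tensor_apply m A x"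
  by (simp add: tensor_apply_def vec_eq_iff prod_list_scaled sum_distrib_left mult.left_commute)

lemma continuous_on_prod_list_component:
  fixes S :: "(real ^ 'n) set"
  shows "continuous_on S (\<lambda>x. \<Prod>j\<leftarrow>js. x $ j)"
  by (induction js) (auto intro!: continuous_intros)

lemma continuous_on_tensor_apply: "continuous_on S (tensor_apply m A)"
  unfolding tensor_apply_def
  by (intro continuous_intros continuous_on_prod_list_component)

lemma P_tensor_order_ge_2:
  fixes A :: "'n::finite list \<Rightarrow> real"
  assumes "m \<ge> 1" and "P_tensor m A"
  shows "m \<ge> 2"
proof (rule ccontr)
  assume "\<not> m \<ge> 2"
  with assms(1) have "m = 1" by simp
  then have const: "tensor_apply m A x = tensor_apply m A 0" for x
    by (simp add: tensor_apply_def)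
  define a where "a = tensor_apply m A 0"
  have P: "\<exists>i. x $ i * a $ i > 0" if "x \<noteq> 0" for x
    using assms(2) that const[of x] unfolding P_tensor_def a_def by metis
  show False
  proof (cases "a = 0")
    case True
    then show False using P[of 1] by simp
  next
    case False
    then obtain i where "(- a) $ i * a $ i > 0" using P[of "- a"] by auto
    then show False using zero_le_square[of "a $ i"] by simp
  qed
qed

section \<open>Bounding complementary vectors\<close>

text \<open>
  The sum of positive parts stands in for the largest product \<open>x\<^sub>i (F x)\<^sub>i\<close>: it is positive exactly
  when some product is, and it is visibly continuous.
\<close>

lemma homogeneous_P_growth:
  fixes F :: "real ^ 'n \<Rightarrow> real ^ 'n"
  assumes cont: "continuous_on UNIV F"
    and hom: "\<And>t x. F (t *\<^sub>R x) = t ^ d *\<^sub>R F x"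
    and P: "\<And>x. x \<noteq> 0 \<Longrightarrow> \<exists>i. x $ i * F x $ i > 0"
  obtains c where "c > 0" and "\<And>x. c * norm x ^ Suc d \<le> (\<Sum>i\<in>UNIV. max 0 (x $ i * F x $ i))"
proof -
  define g where "g x = (\<Sum>i\<in>UNIV. max 0 (x $ i * F x $ i))" for x
  have "continuous_on (sphere 0 1) g"
    unfolding g_def
    by (intro continuous_intros continuous_on_subset[OF cont]) auto
  moreover have "sphere (0::real ^ 'n) 1 \<noteq> {}" by simp
  ultimately obtain u where u: "u \<in> sphere 0 1" and min: "\<And>y. y \<in> sphere 0 1 \<Longrightarrow> g u \<le> g y"
    using continuous_attains_inf[OF compact_sphere] by metis
  from u have "u \<noteq> 0" by auto
  then obtain i where "u $ i * F u $ i > 0" using P by blast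
  then have pos: "g u > 0"
    unfolding g_def by (intro sum_pos2[where i = i]) auto
  have scale: "g (t *\<^sub>R x) = t ^ Suc d * g x" if "t \<ge> 0" for t x
  proof -
    have "max 0 ((t *\<^sub>R x) $ i * F (t *\<^sub>R x) $ i) = t ^ Suc d * max 0 (x $ i * F x $ i)" for i
    proof -
      have "(t *\<^sub>R x) $ i * F (t *\<^sub>R x) $ i = t ^ Suc d * (x $ i * F x $ i)"
        by (simp add: hom)
      then show ?thesis
        using that max_mult_distrib_left[of "t ^ Suc d" 0 "x $ i * F x $ i"]
        by (simp only: zero_le_power if_True mult_zero_right)
    qed
    then show ?thesis unfolding g_def by (simp add: sum_distrib_left)
  qed
  have "g u * norm x ^ Suc d \<le> g x" for x
  proof (cases "x = 0")
    case True
    then show ?thesis by (simp add: g_def)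
  next
    case False
    have "g x = norm x ^ Suc d * g (inverse (norm x) *\<^sub>R x)"
      using scale[of "norm x" "inverse (norm x) *\<^sub>R x"] False by simp
    moreover have "g u \<le> g (inverse (norm x) *\<^sub>R x)"
      using False by (intro min) simp
    ultimately show ?thesis
      by (metis mult.commute mult_right_mono norm_ge_zero zero_le_power)
  qed
  with pos show thesis using that unfolding g_def by blast
qed

lemma homogeneous_P_bounded:
  fixes F :: "real ^ 'n \<Rightarrow> real ^ 'n"
  assumes "continuous_on UNIV F"
    and "\<And>t x. F (t *\<^sub>R x) = t ^ d *\<^sub>R F x"
    and "\<And>x. x \<noteq> 0 \<Longrightarrow> \<exists>i. x $ i * F x $ i > 0"
    and "d \<ge> 1"
  shows "bounded {x. x \<ge> 0 \<and> (\<forall>i. x $ i > 0 \<longrightarrow> (F x + q) $ i \<le> 0)}"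
proof -
  obtain c where "c > 0"
    and growth: "\<And>x. c * norm x ^ Suc d \<le> (\<Sum>i\<in>UNIV. max 0 (x $ i * F x $ i))"
    using homogeneous_P_growth[OF assms(1-3)] by blast
  define Q where "Q = (\<Sum>i\<in>UNIV. \<bar>q $ i\<bar>)"
  have "norm x \<le> max 1 (Q / c)"
    if "x \<ge> 0" and le: "\<And>i. x $ i > 0 \<Longrightarrow> (F x + q) $ i \<le> 0" for x
  proof (cases "norm x \<le> 1")
    case False
    have "max 0 (x $ i * F x $ i) \<le> \<bar>q $ i\<bar> * norm x" for i
    proof (cases "x $ i > 0")
      case True
      then have "F x $ i \<le> \<bar>q $ i\<bar>" using le[of i] by simp
      with True have "x $ i * F x $ i \<le> x $ i * \<bar>q $ i\<bar>" by simp
      also have "\<dots> \<le> norm x * \<bar>q $ i\<bar>"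
        using component_le_norm_cart[of x i] by (intro mult_right_mono) auto
      finally show ?thesis by (simp add: mult.commute)
    next
      case False
      then have "x $ i = 0" using \<open>x \<ge> 0\<close> by (simp add: less_eq_vec_def order_antisym)
      then show ?thesis by simp
    qed
    then have "(\<Sum>i\<in>UNIV. max 0 (x $ i * F x $ i)) \<le> Q * norm x"
      unfolding Q_def sum_distrib_right by (intro sum_mono)
    with growth[of x] have "(c * norm x ^ d) * norm x \<le> Q * norm x"
      by (simp add: mult_ac)
    then have "c * norm x ^ d \<le> Q"
      by (rule mult_right_le_imp_le) (use False in linarith)
    moreover have "norm x \<le> norm x ^ d"
      using False \<open>d \<ge> 1\<close> power_increasing[of 1 d "norm x"] by simp
    ultimately have "c * norm x \<le> Q"
      using \<open>c > 0\<close> by (smt (verit) mult_left_mono)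
    with \<open>c > 0\<close> show ?thesis by (simp add: field_simps le_max_iff_disj)
  qed simp
  then show ?thesis by (auto simp: bounded_iff)
qed

section \<open>Complementarity on a box\<close>

text \<open>
  A vector \<open>x\<close> of the box is fixed by clamping \<open>x - G x\<close> to the box exactly when \<open>G\<close> pushes against the box at
  every face that \<open>x\<close> touches and vanishes in the remaining coordinates.
\<close>

lemma box_complementarity:
  fixes G :: "real ^ 'n \<Rightarrow> real ^ 'n"
  assumes cont: "continuous_on UNIV G" and "r \<ge> 0"
  obtains x where "\<And>i. 0 \<le> x $ i"
    and "\<And>i. x $ i > 0 \<Longrightarrow> G x $ i \<le> 0" and "\<And>i. x $ i < r \<Longrightarrow> G x $ i \<ge> 0"
proof -
  define B where "B = cbox (0::real ^ 'n) (\<chi> i. r)"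
  define h where "h x = (\<chi> i. max 0 (min r (x $ i - G x $ i)))" for x
  have "continuous_on B h"
    unfolding h_def by (intro continuous_intros continuous_on_subset[OF cont]) auto
  moreover have "h \<in> B \<rightarrow> B"
    using \<open>r \<ge> 0\<close> by (auto simp: B_def h_def mem_box_cart)
  moreover have "0 \<in> B"
    using \<open>r \<ge> 0\<close> by (simp add: B_def mem_box_cart)
  then have "B \<noteq> {}" by blast
  moreover have "compact B" and "convex B" by (simp_all add: B_def)
  ultimately obtain x where "x \<in> B" and "h x = x" using brouwer by metis
  have fix_eq: "max 0 (min r (x $ i - G x $ i)) = x $ i" for i
    using arg_cong[OF \<open>h x = x\<close>, of "\<lambda>v. v $ i"] by (simp add: h_def)
  show thesis
  proof
    show "0 \<le> x $ i" for i using fix_eq[of i] by linarith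
    show "G x $ i \<le> 0" if "x $ i > 0" for i using fix_eq[of i] that by linarith
    show "G x $ i \<ge> 0" if "x $ i < r" for i using fix_eq[of i] that by linarith
  qed
qed

section \<open>The solution set\<close>

lemma complementarity_iff:
  fixes x y :: "real ^ 'n"
  assumes "x \<ge> 0" and "y \<ge> 0"
  shows "x \<bullet> y = 0 \<longleftrightarrow> (\<forall>i. x $ i > 0 \<longrightarrow> y $ i \<le> 0)"
proof -
  have "x $ i \<ge> 0" "y $ i \<ge> 0" for i using assms by (simp_all add: less_eq_vec_def)
  then have "x \<bullet> y = 0 \<longleftrightarrow> (\<forall>i. x $ i * y $ i = 0)"
    by (simp add: inner_vec_def sum_nonneg_eq_0_iff)
  also have "\<dots> \<longleftrightarrow> (\<forall>i. x $ i > 0 \<longrightarrow> y $ i \<le> 0)"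
    using \<open>\<And>i. x $ i \<ge> 0\<close> \<open>\<And>i. y $ i \<ge> 0\<close> by (auto simp: less_le order_antisym)
  finally show ?thesis .
qed

lemma closed_TCP_solutions: "closed (TCP_solutions m q A)"
  unfolding TCP_solutions_def less_eq_vec_def zero_index
  by (intro closed_Collect_conj closed_Collect_all closed_Collect_le closed_Collect_eq
      continuous_intros continuous_on_tensor_apply)

theorem mainTheorem1:
  fixes m :: nat and q :: "real ^ 'n::finite" and A :: "'n list \<Rightarrow> real"
  assumes "m \<ge> 1" and "P_tensor m A"
  shows "TCP_solutions m q A \<noteq> {} \<and> compact (TCP_solutions m q A)"
proof -
  let ?F = "tensor_apply m A"
  define V where "V = {x. x \<ge> 0 \<and> (\<forall>i. x $ i > 0 \<longrightarrow> (?F x + q) $ i \<le> 0)}"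
  have "bounded V"
    unfolding V_def
  proof (rule homogeneous_P_bounded)
    show "m - 1 \<ge> 1" using P_tensor_order_ge_2[OF assms] by simp
    show "\<exists>i. x $ i * ?F x $ i > 0" if "x \<noteq> 0" for x
      using assms(2) that unfolding P_tensor_def by blast
  qed (rule continuous_on_tensor_apply tensor_apply_scaleR)+
  have solutions: "TCP_solutions m q A = {x \<in> V. ?F x + q \<ge> 0}"
    unfolding TCP_solutions_def V_def using complementarity_iff by blast
  have "bounded (TCP_solutions m q A)"
    unfolding solutions by (rule bounded_subset[OF \<open>bounded V\<close>]) simp
  then have "compact (TCP_solutions m q A)"
    using closed_TCP_solutions by (simp add: compact_eq_bounded_closed)
  moreover have "TCP_solutions m q A \<noteq> {}"
  proof -
    obtain R where "R > 0" and R: "\<And>x. x \<in> V \<Longrightarrow> norm x \<le> R"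
      using \<open>bounded V\<close> bounded_pos by metis
    have "continuous_on UNIV (\<lambda>x. ?F x + q)"
      by (intro continuous_intros continuous_on_tensor_apply)
    then obtain x where x: "\<And>i. 0 \<le> x $ i" "\<And>i. x $ i > 0 \<Longrightarrow> (?F x + q) $ i \<le> 0"
      "\<And>i. x $ i < R + 1 \<Longrightarrow> (?F x + q) $ i \<ge> 0"
      using box_complementarity[of "\<lambda>x. ?F x + q" "R + 1"] \<open>R > 0\<close> by auto
    have "x \<in> V" using x(1,2) by (simp add: V_def less_eq_vec_def)
    have "x $ i < R + 1" for i
      using R[OF \<open>x \<in> V\<close>] component_le_norm_cart[of x i] by simp
    then have "?F x + q \<ge> 0" using x(3) by (simp add: less_eq_vec_def)
    with \<open>x \<in> V\<close> show ?thesis unfolding solutions by blast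
  qed
  ultimately show ?thesis by blast
qed

end
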